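(* Let $G$ be a finite simple graph and let $u,v$ be distinct vertices of $G$. Then the vertex-identification map $\phi_{u,v}:B(G)\to B(G/\{u,v\})$ is surjective and continuous with respect to the star topologies.
   Context: Graphs are finite and simple: $G=(V(G),E(G))$ with $E(G)$ a set of 2-element subsets of $V(G)$, and $uv$ denotes the edge $\{u,v\}$. The bare representation $B(G)$ is the disjoint union $V(G)\sqcup E(G)$. The open star of $v\in V(G)$ is $S_G(v)=\{v\}\cup\{e\in E(G): e \text{ is incident to } v\}\subseteq B(G)$. The star topology on $B(G)$ is the topology generated by the sub-basis $\{S_G(v):v\in V(G)\}$. Vertex-identification: for distinct vertices $u,v$ of $G$ (adjacent or not) and a new vertex $w$, the graph $G/\{u,v\}$ has vertex set $(V(G)\setminus\{u,v\})\cup\{w\}$ and edge set consisting of all edges of $G$ incident to neither $u$ nor $v$, together with all $wx$ with $x\in V(G)\setminus\{u,v\}$ and ($ux\in E(G)$ or $vx\in E(G)$). The vertex-identification map $\phi_{u,v}:B(G)\to B(G/\{u,v\})$ fixes every vertex other than $u,v$, sends $u$ and $v$ to $w$, fixes every edge incident to neither $u$ nor $v$, sends each edge $ux$ or $vx$ with $x\ne u,v$ to $wx$, and, if $uv\in E(G)$, sends the edge $uv$ to the vertex $w$. *)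

theory Defs
  imports "HOL-Analysis.Analysis"
begin

record 'a ugraph =
  verts :: "'a set"
  edges :: "'a set set"

definition finite_simple_graph :: "'a ugraph \<Rightarrow> bool" where
  "finite_simple_graph G \<longleftrightarrow>
     finite (verts G) \<and> (\<forall>e\<in>edges G. e \<subseteq> verts G \<and> card e = 2)"

definition bare_rep :: "'a ugraph \<Rightarrow> ('a + 'a set) set" where
  "bare_rep G = verts G <+> edges G"

definition open_star :: "'a ugraph \<Rightarrow> 'a \<Rightarrow> ('a + 'a set) set" where
  "open_star G v = {Inl v} \<union> Inr ` {e \<in> edges G. v \<in> e}"

definition star_topology :: "'a ugraph \<Rightarrow> ('a + 'a set) topology" where
  "star_topology G = topology_generated_by (open_star G ` verts G)"

text \<open>The identified graph. The name \<open>w\<close> of the new vertex is a parameter, to be taken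
  outside \<open>verts G\<close>.\<close>

definition identify_vertices :: "'a ugraph \<Rightarrow> 'a \<Rightarrow> 'a \<Rightarrow> 'a \<Rightarrow> 'a ugraph" where
  "identify_vertices G u v w =
     \<lparr>verts = (verts G - {u, v}) \<union> {w},
      edges = {e \<in> edges G. u \<notin> e \<and> v \<notin> e} \<union>
              {{w, x} |x. x \<in> verts G - {u, v} \<and> ({u, x} \<in> edges G \<or> {v, x} \<in> edges G)}\<rparr>"

text \<open>The map is given by a formula on the whole type; only its values on \<open>bare_rep G\<close> matter.
  For an edge \<open>e\<close> that is \<open>{u, x}\<close> or \<open>{v, x}\<close> with \<open>x\<close> different from \<open>u\<close> and \<open>v\<close>, the set
  \<open>{w} \<union> (e - {u, v})\<close> is \<open>{w, x}\<close>.\<close>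

fun identification_map :: "'a \<Rightarrow> 'a \<Rightarrow> 'a \<Rightarrow> 'a + 'a set \<Rightarrow> 'a + 'a set" where
  "identification_map u v w (Inl x) = Inl (if x = u \<or> x = v then w else x)"
| "identification_map u v w (Inr e) =
     (if e = {u, v} then Inl w
      else if u \<in> e \<or> v \<in> e then Inr ({w} \<union> (e - {u, v}))
      else Inr e)"

lemma identification_map_edge:
  assumes "x \<noteq> u" "x \<noteq> v"
  shows "identification_map u v w (Inr {u, x}) = Inr {w, x}"
    and "identification_map u v w (Inr {v, x}) = Inr {w, x}"
proof -
  have "{u, x} \<noteq> {u, v}" "{v, x} \<noteq> {u, v}" using assms by blast+
  moreover have "{u, x} - {u, v} = {x}" "{v, x} - {u, v} = {x}" using assms by auto
  ultimately show "identification_map u v w (Inr {u, x}) = Inr {w, x}"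
    and "identification_map u v w (Inr {v, x}) = Inr {w, x}" by (simp_all add: insert_commute)
qed

lemma finite_simple_graph_identify_vertices:
  assumes "finite_simple_graph G" "w \<notin> verts G"
  shows "finite_simple_graph (identify_vertices G u v w)"
proof -
  have "card {w, x} = 2" if "x \<in> verts G" for x
    using that assms(2) by (metis card_2_iff)
  then show ?thesis
    using assms unfolding finite_simple_graph_def identify_vertices_def by auto
qed

lemma topspace_star_topology:
  assumes "finite_simple_graph G"
  shows "topspace (star_topology G) = bare_rep G"
proof -
  have "\<exists>v\<in>verts G. v \<in> e" if "e \<in> edges G" for e
  proof -
    have "e \<subseteq> verts G" "e \<noteq> {}" using assms that unfolding finite_simple_graph_def by auto
    then show ?thesis by blast
  qed
  then show ?thesis
    unfolding star_topology_def topology_generated_by_topspace bare_rep_def open_star_def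
    by (fastforce simp: Plus_def)
qed

end

theory Submission
  imports Defs
begin

text \<open>Continuity need only be tested on the sub-basis of open stars. Identification leaves
  incidence with a surviving vertex \<open>y\<close> unchanged, so the preimage of the star of
  \<open>y\<close> is the star of \<open>y\<close> in \<open>G\<close>. An edge lands in the star of
  \<open>w\<close> exactly when it meets \<open>u\<close> or \<open>v\<close>, including the edge
  \<open>{u, v}\<close>, which collapses onto \<open>w\<close> itself; hence the preimage of that
  star is the union of the stars of \<open>u\<close> and \<open>v\<close>. Both preimages are open
  (\<open>vimage_identification_map_open_star\<close>). Surjectivity holds because every edge at
  \<open>w\<close> comes from an edge at \<open>u\<close> or \<open>v\<close>
  (\<open>identification_map_image\<close>). Both lemmas rest on the trichotomy for edges in
  \<open>edge_identification_cases\<close>: missing both vertices, joining them, or meeting exactly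
  one.\<close>

lemma edge_identification_cases:
  assumes "finite_simple_graph G" "u \<noteq> v" "e \<in> edges G"
  obtains (away) "u \<notin> e" "v \<notin> e"
    | (collapsed) "e = {u, v}"
    | (incident) x where "x \<in> verts G - {u, v}" "e = {u, x} \<or> e = {v, x}"
proof -
  obtain a b where ab: "e = {a, b}" "a \<noteq> b"
    using assms(1,3) unfolding finite_simple_graph_def by (meson card_2_iff)
  have mem: "a \<in> verts G" "b \<in> verts G"
    using assms(1,3) ab(1) unfolding finite_simple_graph_def by auto
  consider "u \<notin> e" "v \<notin> e" | "e = {u, v}" | "a \<in> {u, v}" "b \<notin> {u, v}" | "a \<notin> {u, v}" "b \<in> {u, v}"
    using ab by fastforce
  then show thesis
  proof cases
    case 3
    then have "e = {u, b} \<or> e = {v, b}" using ab(1) by blast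
    with 3 mem(2) show thesis using incident by blast
  next
    case 4
    then have "e = {u, a} \<or> e = {v, a}" using ab(1) by blast
    with 4 mem(1) show thesis using incident by blast
  qed (fact away, fact collapsed)
qed

text \<open>Besides surjectivity, this supplies well-definedness: the inclusion from left to right
  is what later certifies that images of edges are edges or vertices of the new graph.\<close>

lemma identification_map_image:
  assumes G: "finite_simple_graph G" and uv: "u \<in> verts G" "u \<noteq> v"
  shows "identification_map u v w ` bare_rep G = bare_rep (identify_vertices G u v w)"
proof
  show "identification_map u v w ` bare_rep G \<subseteq> bare_rep (identify_vertices G u v w)"
  proof (rule image_subsetI)
    fix p assume "p \<in> bare_rep G"
    then consider x where "p = Inl x" "x \<in> verts G" | e where "p = Inr e" "e \<in> edges G"
      unfolding bare_rep_def by blast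
    then show "identification_map u v w p \<in> bare_rep (identify_vertices G u v w)"
    proof cases
      case 1
      then show ?thesis by (auto simp: bare_rep_def identify_vertices_def)
    next
      case 2
      from G uv(2) 2(2) show ?thesis
      proof (cases rule: edge_identification_cases)
        case (incident x)
        then have "identification_map u v w p = Inr {w, x}"
          using 2(1) identification_map_edge[of x u v w] by blast
        then show ?thesis
          using incident 2(2) by (auto simp: bare_rep_def identify_vertices_def)
      qed (use 2 in \<open>auto simp: bare_rep_def identify_vertices_def\<close>)
    qed
  qed
next
  show "bare_rep (identify_vertices G u v w) \<subseteq> identification_map u v w ` bare_rep G"
  proof
    fix p assume "p \<in> bare_rep (identify_vertices G u v w)"
    then consider "p = Inl w" | x where "p = Inl x" "x \<in> verts G - {u, v}"
      | e where "p = Inr e" "e \<in> edges G" "u \<notin> e" "v \<notin> e"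
      | x where "p = Inr {w, x}" "x \<in> verts G - {u, v}" "{u, x} \<in> edges G \<or> {v, x} \<in> edges G"
      unfolding bare_rep_def identify_vertices_def by auto
    then show "p \<in> identification_map u v w ` bare_rep G"
    proof cases
      case 1
      then have "p = identification_map u v w (Inl u)" by simp
      then show ?thesis using uv(1) unfolding bare_rep_def by blast
    next
      case (2 x)
      then have "p = identification_map u v w (Inl x)" by simp
      then show ?thesis using 2 unfolding bare_rep_def by blast
    next
      case (3 e)
      then have "p = identification_map u v w (Inr e)" by auto
      then show ?thesis using 3 unfolding bare_rep_def by blast
    next
      case (4 x)
      \<comment> \<open>Only one of the two edges need exist in \<open>G\<close>. Both equations are
        recorded so that whichever edge exists can serve as the preimage.\<close>
      then have "p = identification_map u v w (Inr {u, x})" "p = identification_map u v w (Inr {v, x})"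
        using identification_map_edge[of x u v w] by auto
      then show ?thesis using 4(3) unfolding bare_rep_def by blast
    qed
  qed
qed

lemma mem_open_star_iff:
  "Inl x \<in> open_star G y \<longleftrightarrow> x = y" "Inr e \<in> open_star G y \<longleftrightarrow> e \<in> edges G \<and> y \<in> e"
  by (auto simp: open_star_def)

text \<open>Intersecting with \<open>bare_rep G\<close> matters because the map is total on the
  type: for instance \<open>Inl w\<close>, which is not a point of \<open>bare_rep G\<close>, is
  also sent to \<open>Inl w\<close>.\<close>

lemma vimage_identification_map_open_star:
  assumes G: "finite_simple_graph G" and uv: "u \<in> verts G" "v \<in> verts G" "u \<noteq> v"
    and w: "w \<notin> verts G" and y: "y \<in> verts (identify_vertices G u v w)"
  shows "identification_map u v w -` open_star (identify_vertices G u v w) y \<inter> bare_rep G =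
         (if y = w then open_star G u \<union> open_star G v else open_star G y)" (is "?L = ?R")
proof (rule set_eqI)
  fix p
  have y': "y = w \<or> y \<in> verts G - {u, v}" using y by (auto simp: identify_vertices_def)
  show "p \<in> ?L \<longleftrightarrow> p \<in> ?R"
  proof (cases p)
    case (Inl x)
    then show ?thesis using y' uv w by (auto simp: bare_rep_def mem_open_star_iff)
  next
    case (Inr e)
    show ?thesis
    proof (cases "e \<in> edges G")
      case False
      then show ?thesis using Inr by (auto simp: bare_rep_def mem_open_star_iff)
    next
      case True
      \<comment> \<open>Membership of an edge in a star has two parts, being an edge of the graph
        and containing the centre. \<open>H\<close> settles the first for the image of
        \<open>e\<close>, leaving only incidence to compare.\<close>
      then have "identification_map u v w p \<in> bare_rep (identify_vertices G u v w)"
        using identification_map_image[OF G uv(1,3)] Inr unfolding bare_rep_def by blast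
      then have H: "identification_map u v w (Inr e) \<in> verts (identify_vertices G u v w) <+>
          edges (identify_vertices G u v w)"
        using Inr by (simp only: bare_rep_def)
      \<comment> \<open>Since \<open>w\<close> is new, an edge fixed by the map cannot lie in the
        star of \<open>w\<close>.\<close>
      have "e \<subseteq> verts G" using G True by (auto simp: finite_simple_graph_def)
      then have we: "w \<notin> e" using w by blast
      have "p \<in> ?L \<longleftrightarrow> identification_map u v w (Inr e) \<in> open_star (identify_vertices G u v w) y"
        using Inr True by (simp add: bare_rep_def InrI del: identification_map.simps)
      also have "\<dots> \<longleftrightarrow> (if y = w then u \<in> e \<or> v \<in> e else y \<in> e)"
        using G uv(3) True
      proof (cases rule: edge_identification_cases)
        case away
        then have "identification_map u v w (Inr e) = Inr e" by auto
        moreover from this have "e \<in> edges (identify_vertices G u v w)" using H by auto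
        ultimately show ?thesis using away we by (simp add: mem_open_star_iff)
      next
        case collapsed
        then show ?thesis using y' by (auto simp: mem_open_star_iff)
      next
        case (incident x)
        then have "identification_map u v w (Inr e) = Inr {w, x}"
          using identification_map_edge[of x u v w] by blast
        moreover from this have "{w, x} \<in> edges (identify_vertices G u v w)" using H by auto
        \<comment> \<open>For \<open>y\<close> other than \<open>w\<close>, \<open>y'\<close>
          excludes \<open>u\<close> and \<open>v\<close>, so \<open>y\<close> lies in
          \<open>{w, x}\<close> iff \<open>y = x\<close> iff \<open>y\<close> lies in
          \<open>e\<close>.\<close>
        ultimately show ?thesis using incident y' by (auto simp: mem_open_star_iff)
      qed
      also have "\<dots> \<longleftrightarrow> p \<in> ?R" using Inr True by (simp add: mem_open_star_iff)
      finally show ?thesis .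
    qed
  qed
qed

theorem theorem4p7:
  fixes G :: "'a ugraph" and u v w :: 'a
  assumes "finite_simple_graph G"
    and "u \<in> verts G" and "v \<in> verts G" and "u \<noteq> v"
    and "w \<notin> verts G"
  shows "identification_map u v w ` bare_rep G = bare_rep (identify_vertices G u v w) \<and>
         continuous_map (star_topology G) (star_topology (identify_vertices G u v w))
           (identification_map u v w)"
proof
  let ?H = "identify_vertices G u v w"
  show image: "identification_map u v w ` bare_rep G = bare_rep ?H"
    by (rule identification_map_image[OF assms(1,2,4)])
  have star: "openin (star_topology G) (open_star G x)" if "x \<in> verts G" for x
    unfolding star_topology_def by (rule topology_generated_by_Basis[OF imageI[OF that]])
  show "continuous_map (star_topology G) (star_topology ?H) (identification_map u v w)"
    \<comment> \<open>Only the target is unfolded: the sub-basis criterion needs it as a generated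
      topology, while the source enters through its open sets.\<close>
    unfolding star_topology_def[of ?H]
  proof (rule continuous_on_generated_topo)
    fix U assume "U \<in> open_star ?H ` verts ?H"
    then obtain y where y: "y \<in> verts ?H" "U = open_star ?H y" by blast
    have "y = w \<or> y \<in> verts G" using y(1) by (auto simp: identify_vertices_def)
    then have "openin (star_topology G)
        (if y = w then open_star G u \<union> open_star G v else open_star G y)"
      using star assms(2,3) by (cases "y = w") (simp_all add: openin_Un)
    then show "openin (star_topology G)
        (identification_map u v w -` U \<inter> topspace (star_topology G))"
      unfolding y(2) topspace_star_topology[OF assms(1)]
        vimage_identification_map_open_star[OF assms y(1)] .
  next
    \<comment> \<open>The criterion also requires the image to be covered by the sub-basis. The
      stars cover \<open>bare_rep ?H\<close> because \<open>?H\<close> is again a simple graph, so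
      each edge has an endpoint.\<close>
    have "bare_rep ?H = \<Union> (open_star ?H ` verts ?H)"
      using topspace_star_topology[OF finite_simple_graph_identify_vertices[OF assms(1,5)], of u v]
      unfolding star_topology_def topology_generated_by_topspace by (rule sym)
    then show "identification_map u v w ` topspace (star_topology G) \<subseteq>
        \<Union> (open_star ?H ` verts ?H)"
      using image by (simp only: topspace_star_topology[OF assms(1)])
  qed
qed

end
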